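(* Let $m \geq n$ be positive even integers and let $K_{m,n}$ be the complete bipartite graph with parts of cardinality $m$ and $n$. Then $EBI(K_{m,2}) = \{0\}$. For $n \geq 4$, let $k = \left\lfloor \frac{mn}{n+2} \right\rfloor$, $k' = \frac{mn}{2} \bmod \left(\frac{n}{2}+1\right)$, $j = \left\lfloor \frac{mn}{m+2} \right\rfloor$, and $j' = \frac{mn}{2} \bmod \left(\frac{m}{2}+1\right)$. Then \[ EBI(K_{m,n}) = \begin{cases} \{0,1,\dots, 2(k+j)+2-m-n\}, & \text{if } k' = \frac{n}{2} \text{ and } j' = \frac{m}{2},\\ \{0,1,\dots, 2(k+j)+1-m-n\}, & \text{if either } k' = \frac{n}{2} \text{ or } j' = \frac{m}{2},\\ \{0,1,\dots, 2(k+j)-m-n\}, & \text{if } k' < \frac{n}{2} \text{ and } j' < \frac{m}{2}. \end{cases} \] Here $x \bmod y$ denotes the remainder of $x$ upon division by $y$ (division algorithm).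
   Context: Let $G$ be a graph with vertex set $V$ and edge set $E$. A binary edge-labeling is a function $f: E \to \{0,1\}$; an edge $e$ is an $i$-edge if $f(e)=i$, and $e(i)$ denotes the number of $i$-edges. The labeling $f$ is edge-friendly if $|e(1)-e(0)| \leq 1$. For $v \in V$, $\deg_i(v)$ is the number of $i$-edges incident with $v$. An edge-friendly labeling induces a partial vertex labeling: $v$ is labeled $1$ if $\deg_1(v) > \deg_0(v)$, labeled $0$ if $\deg_0(v) > \deg_1(v)$, and unlabeled if $\deg_1(v) = \deg_0(v)$. Let $v(i)$ be the number of vertices labeled $i$. The edge-balanced index set of $G$ is $EBI(G) = \{ |v(1)-v(0)| : f \text{ is an edge-friendly labeling of } G\}$. *)

theory Defs
  imports Main "HOL-Library.FuncSet"
begin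

text \<open>A simple graph is a pair of a vertex set and a set of edges, each edge being the
  set of its two endpoints.\<close>

type_synonym 'a graph = "'a set \<times> 'a set set"

abbreviation verts :: "'a graph \<Rightarrow> 'a set" where
  "verts G \<equiv> fst G"

abbreviation edges :: "'a graph \<Rightarrow> 'a set set" where
  "edges G \<equiv> snd G"

definition complete_bipartite :: "'a set \<Rightarrow> 'a set \<Rightarrow> 'a graph" where
  "complete_bipartite A B = (A \<union> B, {{a, b} | a b. a \<in> A \<and> b \<in> B})"

definition edge_count :: "'a graph \<Rightarrow> ('a set \<Rightarrow> nat) \<Rightarrow> nat \<Rightarrow> nat" where
  "edge_count G f i = card {e \<in> edges G. f e = i}"

definition edge_friendly :: "'a graph \<Rightarrow> ('a set \<Rightarrow> nat) \<Rightarrow> bool" where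
  "edge_friendly G f \<longleftrightarrow>
     f \<in> edges G \<rightarrow> {0, 1} \<and> \<bar>int (edge_count G f 1) - int (edge_count G f 0)\<bar> \<le> 1"

definition label_degree :: "'a graph \<Rightarrow> ('a set \<Rightarrow> nat) \<Rightarrow> nat \<Rightarrow> 'a \<Rightarrow> nat" where
  "label_degree G f i v = card {e \<in> edges G. v \<in> e \<and> f e = i}"

text \<open>The induced partial labeling; \<open>None\<close> means unlabeled.\<close>

definition vertex_label :: "'a graph \<Rightarrow> ('a set \<Rightarrow> nat) \<Rightarrow> 'a \<Rightarrow> nat option" where
  "vertex_label G f v =
     (if label_degree G f 1 v > label_degree G f 0 v then Some 1
      else if label_degree G f 0 v > label_degree G f 1 v then Some 0
      else None)"

definition vertex_count :: "'a graph \<Rightarrow> ('a set \<Rightarrow> nat) \<Rightarrow> nat \<Rightarrow> nat" where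
  "vertex_count G f i = card {v \<in> verts G. vertex_label G f v = Some i}"

definition EBI :: "'a graph \<Rightarrow> int set" where
  "EBI G = {\<bar>int (vertex_count G f 1) - int (vertex_count G f 0)\<bar> | f. edge_friendly G f}"

end

theory Submission
  imports Defs
begin

text \<open>
  Write \<open>m = 2g\<close>, \<open>n = 2h\<close> and \<open>T = 2gh\<close>. An edge-friendly labeling is a set \<open>X\<close> of \<open>T\<close> cells of
  the grid \<open>A \<times> B\<close>, and \<open>v(1) - v(0)\<close> is the sum of the signs of \<open>|row| - h\<close> and \<open>|column| - g\<close>.

  Upper bound: \<open>x\<close> rows labeled 1 and \<open>u\<close> unlabeled rows need \<open>x (h + 1) + u h \<le> T\<close> cells, whence
  \<open>2x + u \<le> \<lfloor>T / (h + 1)\<rfloor> + \<lfloor>(T + 1) / (h + 1)\<rfloor>\<close>; the second term exceeds the first one exactly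
  if \<open>T\<close> leaves the remainder \<open>h\<close> modulo \<open>h + 1\<close>. Columns are treated alike.

  The bound is attained: take \<open>p = \<lfloor>(T + 1) / (h + 1)\<rfloor>\<close> rows and \<open>q = \<lfloor>(T + 1) / (g + 1)\<rfloor>\<close> columns.
  If \<open>T \<le> p q\<close>, spread the \<open>T\<close> cells over this block with row sizes, and column sizes, as equal
  as possible; otherwise fill the block and put the remaining cells anywhere.

  All smaller values occur: moving a cell within its row or column changes \<open>v(1) - v(0)\<close> by at
  most 1, such moves lead from \<open>X\<close> to its complement, and complementing changes the sign.
\<close>

section \<open>Moving cells\<close>

text \<open>A row has \<open>2h\<close> cells and a column \<open>2g\<close>, so these signs are 1,
  -1 or 0 as the vertex is labeled 1, labeled 0 or unlabeled. With \<open>X\<close> as a relation,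
  transposing the grid is \<open>converse\<close>.\<close>

definition imbalance :: "'a set \<Rightarrow> 'b set \<Rightarrow> nat \<Rightarrow> nat \<Rightarrow> ('a \<times> 'b) set \<Rightarrow> int" where
  "imbalance A B g h X =
     (\<Sum>a\<in>A. sgn (int (card (X `` {a})) - int h)) +
     (\<Sum>b\<in>B. sgn (int (card (X\<inverse> `` {b})) - int g))"

lemma imbalance_converse: "imbalance B A h g (X\<inverse>) = imbalance A B g h X"
  by (simp add: imbalance_def)

lemma sum_card_Image:
  assumes "finite A" "finite B" "X \<subseteq> A \<times> B"
  shows "(\<Sum>a\<in>A. card (X `` {a})) = card X"
proof -
  have "X = Sigma A (\<lambda>a. X `` {a})"
    using assms(3) by auto
  moreover have "finite (X `` {a})" for a
    using assms by (meson finite_Image finite_SigmaI finite_subset)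
  ultimately show ?thesis
    using card_SigmaI[of A "\<lambda>a. X `` {a}"] assms(1) by metis
qed

lemma card_exchange:
  assumes "finite X" "p \<in> X" "q \<notin> X"
  shows "card (insert q (X - {p})) = card X"
  using assms card_Suc_Diff1[of X p] by simp

lemma move_in_column:
  assumes "finite X" "(a, b) \<in> X" "(a', b) \<notin> X"
  defines "Y \<equiv> insert (a', b) (X - {(a, b)})"
  shows "card Y = card X"
    and "card (X `` {a}) = Suc (card (Y `` {a}))"
    and "card (Y `` {a'}) = Suc (card (X `` {a'}))"
    and "x \<noteq> a \<Longrightarrow> x \<noteq> a' \<Longrightarrow> Y `` {x} = X `` {x}"
    and "card (Y\<inverse> `` {y}) = card (X\<inverse> `` {y})"
proof -
  have fin: "finite (X `` {x})" "finite (X\<inverse> `` {y})" for x y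
    using assms(1) by (auto intro: finite_Image)
  have ne: "a \<noteq> a'"
    using assms by auto
  show "card Y = card X"
    unfolding Y_def using assms(1-3) by (rule card_exchange)
  have "Y `` {a} = X `` {a} - {b}"
    using ne by (auto simp: Y_def)
  thus "card (X `` {a}) = Suc (card (Y `` {a}))"
    using fin assms(2) card_Suc_Diff1[of "X `` {a}" b] by simp
  have "Y `` {a'} = insert b (X `` {a'})"
    using ne by (auto simp: Y_def)
  thus "card (Y `` {a'}) = Suc (card (X `` {a'}))"
    using fin assms(3) by simp
  show "x \<noteq> a \<Longrightarrow> x \<noteq> a' \<Longrightarrow> Y `` {x} = X `` {x}"
    by (auto simp: Y_def)
  show "card (Y\<inverse> `` {y}) = card (X\<inverse> `` {y})"
  proof (cases "y = b")
    case True
    hence "Y\<inverse> `` {y} = insert a' (X\<inverse> `` {y} - {a})"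
      by (auto simp: Y_def)
    thus ?thesis
      using fin assms(2,3) True card_exchange[of "X\<inverse> `` {b}" a a'] by simp
  next
    case False
    hence "Y\<inverse> `` {y} = X\<inverse> `` {y}"
      by (auto simp: Y_def)
    thus ?thesis by simp
  qed
qed

lemma sum_split_pair:
  fixes F :: "'a \<Rightarrow> 'b::comm_monoid_add"
  assumes "finite A" "a \<in> A" "a' \<in> A" "a \<noteq> a'"
  shows "sum F A = F a + (F a' + sum F (A - {a, a'}))"
proof -
  have "A - {a} - {a'} = A - {a, a'}" by auto
  thus ?thesis
    using assms by (simp add: sum.remove[of A a] sum.remove[of "A - {a}" a'])
qed

text \<open>Only two row sizes change, one up and one down by 1. Each changes its sign by at most 1,
  and in opposite directions, so the effects do not add up.\<close>

lemma imbalance_move_in_column: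
  assumes "finite A" "finite B" "X \<subseteq> A \<times> B" "(a, b) \<in> X" "(a', b) \<notin> X" "a' \<in> A"
  shows "\<bar>imbalance A B g h (insert (a', b) (X - {(a, b)})) - imbalance A B g h X\<bar> \<le> 1"
proof -
  let ?Y = "insert (a', b) (X - {(a, b)})"
  have "finite X"
    using assms by (meson finite_SigmaI finite_subset)
  note mv = move_in_column[OF this assms(4,5)]
  have a: "a \<in> A" "a \<noteq> a'"
    using assms by auto
  let ?F = "\<lambda>Z x. sgn (int (card (Z `` {x})) - int h)"
  have "sum (?F ?Y) (A - {a, a'}) = sum (?F X) (A - {a, a'})"
    by (rule sum.cong) (auto simp: mv(4))
  \<comment> \<open>Both changes are written as an increase by 1, the losing row being read from
    \<open>?Y\<close> back to \<open>X\<close>, so that \<open>step\<close> covers both.\<close>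
  moreover have "sgn (int (card (X `` {a})) - int h) = sgn (int (card (?Y `` {a})) + 1 - int h)"
    "sgn (int (card (?Y `` {a'})) - int h) = sgn (int (card (X `` {a'})) + 1 - int h)"
    by (simp_all only: mv(2,3) of_nat_Suc add.commute)
  moreover have step: "sgn z \<le> sgn (z + 1)" "sgn (z + 1) \<le> sgn z + 1" for z :: int
    by (auto simp: sgn_if)
  have "sgn (int x - int h) \<le> sgn (int x + 1 - int h)"
    "sgn (int x + 1 - int h) \<le> sgn (int x - int h) + 1" for x
    using step[of "int x - int h"] by (simp_all add: algebra_simps)
  note this[of "card (X `` {a'})"] this[of "card (?Y `` {a})"]
  ultimately show ?thesis
    unfolding imbalance_def mv(5)
      sum_split_pair[OF assms(1) a(1) assms(6) a(2), of "?F ?Y"]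
      sum_split_pair[OF assms(1) a(1) assms(6) a(2), of "?F X"]
    by linarith
qed

lemma imbalance_move_in_row:
  assumes "finite A" "finite B" "X \<subseteq> A \<times> B" "(a, b) \<in> X" "(a, b') \<notin> X" "b' \<in> B"
  shows "\<bar>imbalance A B g h (insert (a, b') (X - {(a, b)})) - imbalance A B g h X\<bar> \<le> 1"
proof -
  have "(insert (a, b') (X - {(a, b)}))\<inverse> = insert (b', a) (X\<inverse> - {(b, a)})"
    by auto
  thus ?thesis
    using imbalance_move_in_column[of B A "X\<inverse>" b a b' h g] assms
    by (metis converse.intros converseD converse_Times converse_mono imbalance_converse)
qed

text \<open>A swap of \<open>(a, b)\<close> for \<open>(c, d)\<close> is composed of two moves through \<open>(a, d)\<close>, taken in the
  order that depends on whether \<open>(a, d)\<close> is occupied.\<close>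

lemma imbalance_swap_intermediate:
  assumes "finite A" "finite B" "X \<subseteq> A \<times> B" "p \<in> X" "q \<in> A \<times> B - X"
    and "z \<in> {imbalance A B g h X .. imbalance A B g h (insert q (X - {p}))}
           \<union> {imbalance A B g h (insert q (X - {p})) .. imbalance A B g h X}"
  shows "\<exists>Z\<subseteq>A \<times> B. card Z = card X \<and> imbalance A B g h Z = z"
proof -
  let ?I = "imbalance A B g h"
  obtain a b c d where pq: "p = (a, b)" "q = (c, d)"
    by (metis surj_pair)
  have mem: "a \<in> A" "b \<in> B" "c \<in> A" "d \<in> B" "(c, d) \<notin> X" "(a, b) \<in> X"
    using assms pq by auto
  have finX: "finite X"
    using assms by (meson finite_SigmaI finite_subset)
  let ?Y = "insert (c, d) (X - {(a, b)})"
  have Y: "?Y \<subseteq> A \<times> B" "card ?Y = card X"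
    using assms(3) mem card_exchange[OF finX] by auto
  have "\<exists>W\<subseteq>A \<times> B. card W = card X \<and> \<bar>?I W - ?I X\<bar> \<le> 1 \<and> \<bar>?I ?Y - ?I W\<bar> \<le> 1"
  proof (cases "b = d \<or> a = c")
    \<comment> \<open>Cells sharing a row or a column need a single move, so \<open>W = X\<close>
      serves.\<close>
    case True
    hence "\<bar>?I ?Y - ?I X\<bar> \<le> 1"
      using imbalance_move_in_column[of A B X a b c] imbalance_move_in_row[of A B X a b d]
        assms mem by auto
    thus ?thesis
      using assms(3) by (intro exI[of _ X]) auto
  next
    case ne: False
    show ?thesis
    proof (cases "(a, d) \<in> X")
      case False
      let ?W = "insert (a, d) (X - {(a, b)})"
      have W: "?W \<subseteq> A \<times> B" "card ?W = card X"
        using assms(3) mem False card_exchange[OF finX] by auto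
      have "?Y = insert (c, d) (?W - {(a, d)})"
        using False ne by auto
      moreover have "\<bar>?I ?W - ?I X\<bar> \<le> 1"
        using imbalance_move_in_row[of A B X a b d] assms mem False by auto
      moreover have "\<bar>?I (insert (c, d) (?W - {(a, d)})) - ?I ?W\<bar> \<le> 1"
        using imbalance_move_in_column[OF assms(1,2) W(1), of a d c] assms mem ne by auto
      ultimately show ?thesis
        using W by (intro exI[of _ ?W]) simp
    next
      case True
      let ?W = "insert (c, d) (X - {(a, d)})"
      have W: "?W \<subseteq> A \<times> B" "card ?W = card X"
        using assms(3) mem True card_exchange[OF finX] by auto
      have "?Y = insert (a, d) (?W - {(a, b)})"
        using True ne mem by auto
      moreover have "\<bar>?I ?W - ?I X\<bar> \<le> 1"
        using imbalance_move_in_column[of A B X a d c] assms mem True by auto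
      moreover have "\<bar>?I (insert (a, d) (?W - {(a, b)})) - ?I ?W\<bar> \<le> 1"
        using imbalance_move_in_row[OF assms(1,2) W(1), of a b d] assms mem ne by auto
      ultimately show ?thesis
        using W by (intro exI[of _ ?W]) simp
    qed
  qed
  then obtain W where W: "W \<subseteq> A \<times> B" "card W = card X"
    "\<bar>?I W - ?I X\<bar> \<le> 1" "\<bar>?I ?Y - ?I W\<bar> \<le> 1"
    by blast
  \<comment> \<open>The three values differ successively by at most 1, so no integer between the
    outer two is skipped.\<close>
  have "z = ?I X \<or> z = ?I W \<or> z = ?I ?Y"
    using assms(6) W(3,4) unfolding pq Un_iff atLeastAtMost_iff by linarith
  thus ?thesis
    using assms(3) W(1,2) Y by metis
qed

text \<open>A discrete intermediate value argument: swap cells of \<open>X - Y\<close> for cells of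
  \<open>Y - X\<close> one at a time. Either a swap takes the value to \<open>z\<close> or past it,
  or the value stays above \<open>z\<close> and \<open>X\<close> has come closer to
  \<open>Y\<close>.\<close>

lemma imbalance_intermediate:
  assumes "finite A" "finite B" "X \<subseteq> A \<times> B" "Y \<subseteq> A \<times> B" "card X = card Y"
    and "imbalance A B g h Y \<le> z" "z \<le> imbalance A B g h X"
  shows "\<exists>Z\<subseteq>A \<times> B. card Z = card Y \<and> imbalance A B g h Z = z"
  using assms(3,5,7)
proof (induction "card (X - Y)" arbitrary: X rule: less_induct)
  case less
  let ?I = "imbalance A B g h"
  have fin: "finite X" "finite Y"
    using assms less.prems by (meson finite_SigmaI finite_subset)+
  show ?case
  proof (cases "X = Y")
    case True
    thus ?thesis
      using less.prems assms(6) by auto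
  next
    case False
    \<comment> \<open>Equal cardinalities make both differences nonempty.\<close>
    then obtain p q where pq: "p \<in> X" "p \<notin> Y" "q \<in> Y" "q \<notin> X"
      using fin less.prems(2) by (metis card_subset_eq subsetI)
    let ?X = "insert q (X - {p})"
    have "?X - Y = (X - Y) - {p}"
      using pq by auto
    hence "card (?X - Y) < card (X - Y)"
      using pq fin by (metis DiffI card_Diff1_less finite_Diff)
    moreover have "?X \<subseteq> A \<times> B" "card ?X = card Y"
      using pq assms(4) less.prems card_exchange[OF fin(1)] by auto
    moreover have "\<exists>Z\<subseteq>A \<times> B. card Z = card Y \<and> ?I Z = z" if "?I ?X \<le> z"
      using imbalance_swap_intermediate[OF assms(1,2) less.prems(1) pq(1), of q z g h] that
        less.prems pq assms(4) by auto
    ultimately show ?thesis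
      using less.hyps[of ?X] by (meson linear)
  qed
qed

text \<open>\<open>R\<close> and its complement lie at equal distances on opposite sides of
  \<open>t\<close>. The first equation serves complements of cell sets, the second turns a
  comparison of label degrees into one with half the degree.\<close>

lemma sgn_card_Diff_half:
  assumes "finite S" "R \<subseteq> S" "card S = 2 * t"
  shows "sgn (int (card (S - R)) - int t) = - sgn (int (card R) - int t)"
    and "sgn (int (card R) - int (card (S - R))) = sgn (int (card R) - int t)"
proof -
  have "card R \<le> 2 * t"
    using assms card_mono by metis
  hence "int (card (S - R)) = 2 * int t - int (card R)"
    using assms by (simp add: card_Diff_subset finite_subset)
  thus "sgn (int (card (S - R)) - int t) = - sgn (int (card R) - int t)"
    and "sgn (int (card R) - int (card (S - R))) = sgn (int (card R) - int t)"
    by (auto simp: sgn_if)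
qed

lemma imbalance_complement:
  assumes "finite A" "finite B" "card A = 2 * g" "card B = 2 * h" "X \<subseteq> A \<times> B"
  shows "imbalance A B g h (A \<times> B - X) = - imbalance A B g h X"
proof -
  have rows: "(A \<times> B - X) `` {a} = B - X `` {a}" "X `` {a} \<subseteq> B" if "a \<in> A" for a
    using that assms(5) by auto
  have cols: "(A \<times> B - X)\<inverse> `` {b} = A - X\<inverse> `` {b}" "X\<inverse> `` {b} \<subseteq> A" if "b \<in> B" for b
    using that assms(5) by auto
  show ?thesis
    unfolding imbalance_def
    by (simp add: rows cols sgn_card_Diff_half assms sum_negf)
qed

section \<open>The upper bound\<close>

text \<open>Two unlabeled rows cost \<open>2h \<ge> h + 1\<close> cells, so they can be traded for one row labeled 1;
  this reduces the claim to \<open>u \<le> 1\<close>.\<close>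

lemma div_add_div_ge:
  fixes x u h T :: nat
  assumes "1 \<le> h" "x * (h + 1) + u * h \<le> T"
  shows "2 * x + u \<le> T div (h + 1) + (T + 1) div (h + 1)"
proof -
  define y where "y = x + u div 2"
  have "(u div 2) * (h + 1) + (u mod 2) * h \<le> u * h"
  proof -
    have "(u div 2) * (h + 1) \<le> (u div 2) * (2 * h)"
      using assms(1) by (intro mult_left_mono) auto
    moreover have "u * h = (2 * (u div 2) + u mod 2) * h"
      by simp
    ultimately show ?thesis
      by (simp only: algebra_simps)
  qed
  hence y: "y * (h + 1) + (u mod 2) * h \<le> T"
    using assms(2) unfolding y_def by (simp only: algebra_simps)
  have "y \<le> T div (h + 1)"
    using y by (simp add: less_eq_div_iff_mult_less_eq)
  moreover have "y + u mod 2 \<le> (T + 1) div (h + 1)"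
  proof (cases "even u")
    case True
    thus ?thesis
      using y by (simp add: less_eq_div_iff_mult_less_eq)
  next
    case False
    hence "u mod 2 = 1" by presburger
    \<comment> \<open>The leftover unlabeled row costs \<open>h\<close>, one cell short of a row
      labeled 1; the extra 1 in \<open>T + 1\<close> pays for it.\<close>
    moreover have "(y + 1) * (h + 1) \<le> T + 1"
      using y \<open>u mod 2 = 1\<close> by simp
    ultimately show ?thesis
      by (simp add: less_eq_div_iff_mult_less_eq)
  qed
  moreover have "2 * (u div 2) + u mod 2 = u"
    by simp
  ultimately show ?thesis
    unfolding y_def by linarith
qed

text \<open>Each sign is twice the indicator of \<open>r a > h\<close> plus that of
  \<open>r a = h\<close>, minus 1, so the sum is \<open>2x + u - card A\<close> and
  \<open>div_add_div_ge\<close> applies.\<close>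

lemma sum_sgn_le:
  fixes r :: "'a \<Rightarrow> nat" and A :: "'a set"
  assumes "1 \<le> h"
  defines "T \<equiv> (\<Sum>a\<in>A. r a)"
  shows "(\<Sum>a\<in>A. sgn (int (r a) - int h))
           \<le> int (T div (h + 1)) + int ((T + 1) div (h + 1)) - int (card A)"
proof -
  define x u where "x = (\<Sum>a\<in>A. of_bool (r a > h) :: nat)"
    and "u = (\<Sum>a\<in>A. of_bool (r a = h) :: nat)"
  have "x * (h + 1) + u * h = (\<Sum>a\<in>A. of_bool (r a > h) * (h + 1) + of_bool (r a = h) * h)"
    unfolding x_def u_def by (simp only: sum_distrib_right sum.distrib)
  also have "\<dots> \<le> T"
    unfolding T_def by (rule sum_mono) auto
  finally have "2 * x + u \<le> T div (h + 1) + (T + 1) div (h + 1)"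
    using assms(1) by (rule div_add_div_ge[rotated])
  moreover have "(\<Sum>a\<in>A. sgn (int (r a) - int h))
      = (\<Sum>a\<in>A. 2 * int (of_bool (r a > h)) + int (of_bool (r a = h)) - 1)"
    by (rule sum.cong) (auto simp: sgn_if)
  moreover have "\<dots> = 2 * int x + int u - int (card A)"
    unfolding x_def u_def by (simp add: sum.distrib sum_subtractf sum_distrib_left)
  ultimately show ?thesis
    by linarith
qed

lemma imbalance_le:
  assumes "finite A" "finite B" "X \<subseteq> A \<times> B" "1 \<le> g" "1 \<le> h" "card X = T"
  shows "imbalance A B g h X
    \<le> int (T div (h + 1)) + int ((T + 1) div (h + 1)) - int (card A)
      + (int (T div (g + 1)) + int ((T + 1) div (g + 1)) - int (card B))"
proof -
  have "X\<inverse> \<subseteq> B \<times> A" "card (X\<inverse>) = T"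
    using assms by auto
  hence "(\<Sum>b\<in>B. card (X\<inverse> `` {b})) = T"
    using sum_card_Image[of B A "X\<inverse>"] assms by simp
  moreover have "(\<Sum>a\<in>A. card (X `` {a})) = T"
    using sum_card_Image assms by blast
  ultimately show ?thesis
    unfolding imbalance_def
    using sum_sgn_le[OF assms(5), of "\<lambda>a. card (X `` {a})" A]
      sum_sgn_le[OF assms(4), of "\<lambda>b. card (X\<inverse> `` {b})" B]
    by simp
qed

section \<open>The bound is attained\<close>

lemma move_decreases_sum_squares:
  assumes "finite P" "finite Q" "X \<subseteq> P \<times> Q" "a \<in> P" "a' \<in> P"
    and gt: "card (X `` {a}) > card (X `` {a'}) + 1"
  shows "\<exists>Y\<subseteq>P \<times> Q. card Y = card X \<and>
    (\<Sum>a\<in>P. (card (Y `` {a}))\<^sup>2) < (\<Sum>a\<in>P. (card (X `` {a}))\<^sup>2) \<and>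
    (\<Sum>b\<in>Q. (card (Y\<inverse> `` {b}))\<^sup>2) = (\<Sum>b\<in>Q. (card (X\<inverse> `` {b}))\<^sup>2)"
proof -
  have finX: "finite X"
    using assms by (meson finite_SigmaI finite_subset)
  \<comment> \<open>The larger row cannot lie inside the smaller one, which yields a column
    \<open>b\<close> to move along.\<close>
  have "\<not> X `` {a} \<subseteq> X `` {a'}"
    using gt card_mono[of "X `` {a'}" "X `` {a}"] finite_Image[OF finX] by fastforce
  then obtain b where b: "(a, b) \<in> X" "(a', b) \<notin> X"
    by auto
  let ?Y = "insert (a', b) (X - {(a, b)})"
  let ?F = "\<lambda>Z x. (card (Z `` {x}))\<^sup>2"
  note mv = move_in_column[OF finX b]
  have "a \<noteq> a'"
    using b by auto
  note split = sum_split_pair[OF assms(1,4,5) this]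
  have "sum (?F ?Y) (P - {a, a'}) = sum (?F X) (P - {a, a'})"
    by (rule sum.cong) (auto simp: mv(4))
  \<comment> \<open>The two sides differ by \<open>2 * (s - t)\<close>; \<open>s\<close> is the size
    of row \<open>a\<close> after the move, \<open>t\<close> that of row \<open>a'\<close> before
    it.\<close>
  moreover have "s\<^sup>2 + (Suc t)\<^sup>2 < (Suc s)\<^sup>2 + t\<^sup>2" if "t < s" for s t :: nat
    using that by (simp add: power2_eq_square)
  from this[of "card (X `` {a'})" "card (?Y `` {a})"]
  have "?F ?Y a + ?F ?Y a' < ?F X a + ?F X a'"
    using gt unfolding mv(2,3) by simp
  ultimately have "sum (?F ?Y) P < sum (?F X) P"
    unfolding split[of "?F ?Y"] split[of "?F X"] by linarith
  moreover have "?Y \<subseteq> P \<times> Q"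
    using assms(3,5) b by auto
  ultimately show ?thesis
    using mv(1,5) by (intro exI[of _ ?Y]) simp
qed

text \<open>Any set minimising the sum of the squares of all row and column sizes is balanced.\<close>

lemma balanced_rectangle:
  assumes "finite P" "finite Q" "T \<le> card P * card Q"
  obtains X where "X \<subseteq> P \<times> Q" "card X = T"
    and "\<And>a a'. a \<in> P \<Longrightarrow> a' \<in> P \<Longrightarrow> card (X `` {a}) \<le> card (X `` {a'}) + 1"
    and "\<And>b b'. b \<in> Q \<Longrightarrow> b' \<in> Q \<Longrightarrow> card (X\<inverse> `` {b}) \<le> card (X\<inverse> `` {b'}) + 1"
proof -
  \<comment> \<open>One minimiser is balanced both ways because a move that lowers one of the two
    sums leaves the other fixed.\<close>
  define S where "S X = (\<Sum>a\<in>P. (card (X `` {a}))\<^sup>2) + (\<Sum>b\<in>Q. (card (X\<inverse> `` {b}))\<^sup>2)" for X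
  obtain X0 where "X0 \<subseteq> P \<times> Q" "card X0 = T"
    using assms obtain_subset_with_card_n[of T "P \<times> Q"] by (auto simp: card_cartesian_product)
  then obtain X where X: "X \<subseteq> P \<times> Q" "card X = T"
    and least: "\<And>Y. Y \<subseteq> P \<times> Q \<Longrightarrow> card Y = T \<Longrightarrow> S X \<le> S Y"
    using ex_has_least_nat[of "\<lambda>X. X \<subseteq> P \<times> Q \<and> card X = T" X0 S] by auto
  show thesis
  proof (rule that[OF X])
    fix a a' assume a: "a \<in> P" "a' \<in> P"
    show "card (X `` {a}) \<le> card (X `` {a'}) + 1"
    proof (rule ccontr)
      assume "\<not> ?thesis"
      with move_decreases_sum_squares[OF assms(1,2) X(1) a]
      obtain Y where "Y \<subseteq> P \<times> Q" "card Y = card X" "S Y < S X"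
        unfolding S_def by fastforce
      thus False
        using least[of Y] X(2) by simp
    qed
  next
    fix b b' assume b: "b \<in> Q" "b' \<in> Q"
    show "card (X\<inverse> `` {b}) \<le> card (X\<inverse> `` {b'}) + 1"
    proof (rule ccontr)
      assume "\<not> ?thesis"
      moreover have "X\<inverse> \<subseteq> Q \<times> P"
        using X(1) by auto
      ultimately obtain Y where Y: "Y \<subseteq> Q \<times> P" "card Y = card (X\<inverse>)" "S (Y\<inverse>) < S X"
        using move_decreases_sum_squares[OF assms(2,1) _ b, of "X\<inverse>"]
        unfolding S_def converse_converse by fastforce
      have "Y\<inverse> \<subseteq> P \<times> Q"
        using Y(1) by auto
      thus False
        using least[of "Y\<inverse>"] X(2) Y(2,3) by simp
    qed
  qed
qed

text \<open>Every element outside \<open>P\<close> contributes at least -1.\<close>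

lemma sum_sgn_ge_on_subset:
  fixes r :: "'a \<Rightarrow> nat"
  assumes "finite A" "P \<subseteq> A"
  shows "(\<Sum>a\<in>P. sgn (int (r a) - int h)) + int (card P) - int (card A)
    \<le> (\<Sum>a\<in>A. sgn (int (r a) - int h))"
proof -
  have "(\<Sum>a\<in>A - P. - 1) \<le> (\<Sum>a\<in>A - P. sgn (int (r a) - int h))"
    by (rule sum_mono) (auto simp: sgn_if)
  moreover have "card (A - P) + card P = card A"
    using assms by (metis card_Diff_subset card_mono finite_subset le_add_diff_inverse2)
  ultimately show ?thesis
    using sum.subset_diff[OF assms(2,1), of "\<lambda>a. sgn (int (r a) - int h)"] by simp
qed

text \<open>Either all of \<open>P\<close> exceeds \<open>h\<close>, or balance forces
  \<open>r a \<le> h + 1\<close> on \<open>P\<close>. In the latter case each sign is at least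
  \<open>r a - h\<close>, so the signs over \<open>P\<close> add up to at least
  \<open>T - p * h\<close>.\<close>

lemma sum_sgn_ge_balanced:
  fixes r :: "'a \<Rightarrow> nat"
  assumes "finite A" "P \<subseteq> A" "card P = (T + 1) div (h + 1)" "(\<Sum>a\<in>P. r a) = T"
    and bal: "\<And>a a'. a \<in> P \<Longrightarrow> a' \<in> P \<Longrightarrow> r a \<le> r a' + 1"
  shows "int (T div (h + 1)) + int ((T + 1) div (h + 1)) - int (card A)
    \<le> (\<Sum>a\<in>A. sgn (int (r a) - int h))"
proof -
  have "int (T div (h + 1)) \<le> (\<Sum>a\<in>P. sgn (int (r a) - int h))"
  proof (cases "\<forall>a\<in>P. h < r a")
    case True
    hence "(\<Sum>a\<in>P. sgn (int (r a) - int h)) = (\<Sum>a\<in>P. 1)"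
      by (intro sum.cong) auto
    thus ?thesis
      using assms(3) div_le_mono[of T "T + 1" "h + 1"] by simp
  next
    case False
    then obtain a0 where "a0 \<in> P" "r a0 \<le> h"
      by auto
    hence le: "r a \<le> h + 1" if "a \<in> P" for a
      using bal[OF that, of a0] by simp
    define k p where "k = T div (h + 1)" and "p = (T + 1) div (h + 1)"
    have "k * (h + 1) \<le> T" "p * (h + 1) \<le> T + 1"
      unfolding k_def p_def by (simp_all only: div_times_less_eq_dividend)
    moreover have "p = k \<or> p = k + 1"
      unfolding k_def p_def by (simp add: div_Suc)
    \<comment> \<open>If \<open>p = k\<close> this is the first inequality; if
      \<open>p = k + 1\<close> it is the second, less 1 on both sides.\<close>
    ultimately have "k + p * h \<le> T"
      by auto
    hence "int k \<le> int T - int p * int h"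
      by (metis le_diff_eq of_nat_add of_nat_le_iff of_nat_mult)
    also have "\<dots> = (\<Sum>a\<in>P. int (r a) - int h)"
      using assms(3,4) by (simp add: sum_subtractf p_def flip: of_nat_sum)
    also have "\<dots> \<le> (\<Sum>a\<in>P. sgn (int (r a) - int h))"
      by (rule sum_mono) (use le in \<open>force simp: sgn_if\<close>)
    finally show ?thesis
      unfolding k_def .
  qed
  thus ?thesis
    using sum_sgn_ge_on_subset[OF assms(1,2), of r h] assms(3) by linarith
qed

text \<open>Rows and columns that miss the block are charged -1 each, so it suffices that the signs
  over the chosen rows add up to at least \<open>T div (h + 1)\<close>, and over the chosen columns
  to at least \<open>T div (g + 1)\<close>.\<close>

lemma imbalance_attains:
  assumes "finite A" "finite B" "card A = 2 * g" "card B = 2 * h" "2 \<le> g" "2 \<le> h"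
  defines "T \<equiv> 2 * g * h"
  shows "\<exists>X\<subseteq>A \<times> B. card X = T \<and>
    int (T div (h + 1)) + int ((T + 1) div (h + 1)) - int (card A)
      + (int (T div (g + 1)) + int ((T + 1) div (g + 1)) - int (card B)) \<le> imbalance A B g h X"
proof -
  define p q where "p = (T + 1) div (h + 1)" and "q = (T + 1) div (g + 1)"
  have "T + 1 \<le> 2 * g * (h + 1)" "T + 1 \<le> 2 * h * (g + 1)"
    unfolding T_def using assms(5,6) by (simp_all add: algebra_simps)
  hence "p \<le> card A" "q \<le> card B"
    unfolding p_def q_def assms(3,4) using div_le_mono
    by (metis add_gr_0 nonzero_mult_div_cancel_right not_gr_zero zero_less_one)+
  then obtain P Q where PQ: "P \<subseteq> A" "card P = p" "Q \<subseteq> B" "card Q = q"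
    using obtain_subset_with_card_n by metis
  have fin: "finite P" "finite Q"
    using PQ assms finite_subset by blast+
  show ?thesis
  proof (cases "T \<le> p * q")
    case True
    then obtain X where X: "X \<subseteq> P \<times> Q" "card X = T"
      and bal: "\<And>a a'. a \<in> P \<Longrightarrow> a' \<in> P \<Longrightarrow> card (X `` {a}) \<le> card (X `` {a'}) + 1"
        "\<And>b b'. b \<in> Q \<Longrightarrow> b' \<in> Q \<Longrightarrow> card (X\<inverse> `` {b}) \<le> card (X\<inverse> `` {b'}) + 1"
      using balanced_rectangle[OF fin, of T] PQ by metis
    have "(\<Sum>a\<in>P. card (X `` {a})) = T"
      using sum_card_Image[OF fin X(1)] X(2) by simp
    moreover have "(\<Sum>b\<in>Q. card (X\<inverse> `` {b})) = T"
      using sum_card_Image[of Q P "X\<inverse>"] fin X by auto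
    ultimately have "int (T div (h + 1)) + int ((T + 1) div (h + 1)) - int (card A)
        + (int (T div (g + 1)) + int ((T + 1) div (g + 1)) - int (card B)) \<le> imbalance A B g h X"
      unfolding imbalance_def
      using PQ p_def q_def assms(1,2) bal
      by (intro add_mono sum_sgn_ge_balanced[where P = P] sum_sgn_ge_balanced[where P = Q]) auto
    thus ?thesis
      using X PQ by blast
  next
    case False
    \<comment> \<open>This is equivalent to \<open>(g + 1) * (h + 1) \<le> T + 1\<close>, whence
      \<open>g < p\<close> and \<open>h < q\<close>: every row and column of a filled block is then
      labeled 1.\<close>
    have "g + h \<le> g * h"
    proof -
      obtain g' h' where "g = g' + 2" "h = h' + 2"
        using assms(5,6) by (metis add.commute le_Suc_ex)
      thus ?thesis by simp
    qed
    hence "(g + 1) * (h + 1) \<le> T + 1"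
      unfolding T_def by simp
    hence pq: "g < p" "h < q"
      unfolding p_def q_def
      by (simp_all add: less_eq_div_iff_mult_less_eq Suc_le_eq[symmetric] mult.commute)
    have "card (P \<times> Q) \<le> T" "T \<le> card (A \<times> B)" "P \<times> Q \<subseteq> A \<times> B"
      using False PQ assms by (auto simp: card_cartesian_product T_def)
    then obtain X where X: "P \<times> Q \<subseteq> X" "X \<subseteq> A \<times> B" "card X = T"
      using exists_subset_between[of "P \<times> Q" T "A \<times> B"] assms by auto
    have "finite X"
      using X assms by (meson finite_SigmaI finite_subset)
    hence finI: "finite (X `` {a})" "finite (X\<inverse> `` {b})" for a b
      by (auto intro: finite_Image)
    have "h < card (X `` {a})" if "a \<in> P" for a
      using that X(1) PQ(4) pq(2) card_mono[OF finI(1), of Q a] by fastforce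
    hence "(\<Sum>a\<in>P. sgn (int (card (X `` {a})) - int h)) = (\<Sum>a\<in>P. 1)"
      by (intro sum.cong) auto
    moreover have "g < card (X\<inverse> `` {b})" if "b \<in> Q" for b
      using that X(1) PQ(2) pq(1) card_mono[OF finI(2), of P b] by fastforce
    hence "(\<Sum>b\<in>Q. sgn (int (card (X\<inverse> `` {b})) - int g)) = (\<Sum>b\<in>Q. 1)"
      by (intro sum.cong) auto
    moreover have "T div (h + 1) \<le> p" "T div (g + 1) \<le> q"
      unfolding p_def q_def by (simp_all add: div_le_mono)
    ultimately have "int (T div (h + 1)) + int p - int (card A)
        + (int (T div (g + 1)) + int q - int (card B)) \<le> imbalance A B g h X"
      unfolding imbalance_def
      using sum_sgn_ge_on_subset[OF assms(1) PQ(1), of "\<lambda>a. card (X `` {a})" h]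
        sum_sgn_ge_on_subset[OF assms(2) PQ(3), of "\<lambda>b. card (X\<inverse> `` {b})" g] PQ
      by simp
    thus ?thesis
      using X unfolding p_def q_def by blast
  qed
qed

section \<open>Labelings as sets of cells\<close>

text \<open>Edges are unordered; orienting them from \<open>A\<close> to \<open>B\<close> turns a
  label class into a set of grid cells.\<close>

definition label_class :: "'a set \<Rightarrow> 'a set \<Rightarrow> ('a set \<Rightarrow> nat) \<Rightarrow> nat \<Rightarrow> ('a \<times> 'a) set" where
  "label_class A B f i = {(a, b). a \<in> A \<and> b \<in> B \<and> f {a, b} = i}"

lemma label_class_subset: "label_class A B f i \<subseteq> A \<times> B"
  by (auto simp: label_class_def)

lemma label_class_0:
  assumes "f \<in> edges (complete_bipartite A B) \<rightarrow> {0, 1}"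
  shows "label_class A B f 0 = A \<times> B - label_class A B f 1"
  using assms by (fastforce simp: label_class_def complete_bipartite_def)

text \<open>Disjointness of the parts makes each edge come from exactly one cell.\<close>

lemma edge_count_complete_bipartite:
  assumes "A \<inter> B = {}"
  shows "edge_count (complete_bipartite A B) f i = card (label_class A B f i)"
proof -
  have "inj_on (\<lambda>(a, b). {a, b}) (label_class A B f i)"
    using assms by (auto simp: inj_on_def label_class_def doubleton_eq_iff)
  moreover have "{e \<in> edges (complete_bipartite A B). f e = i}
      = (\<lambda>(a, b). {a, b}) ` label_class A B f i"
    by (auto simp: label_class_def complete_bipartite_def)
  ultimately show ?thesis
    unfolding edge_count_def by (simp add: card_image)
qed

lemma label_degree_complete_bipartite_left:
  assumes "A \<inter> B = {}" "a \<in> A"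
  shows "label_degree (complete_bipartite A B) f i a = card (label_class A B f i `` {a})"
proof -
  have "inj_on (\<lambda>b. {a, b}) (label_class A B f i `` {a})"
    by (auto simp: inj_on_def doubleton_eq_iff)
  moreover have "{e \<in> edges (complete_bipartite A B). a \<in> e \<and> f e = i}
      = (\<lambda>b. {a, b}) ` (label_class A B f i `` {a})"
    using assms by (auto simp: label_class_def complete_bipartite_def)
  ultimately show ?thesis
    unfolding label_degree_def by (simp add: card_image)
qed

lemma complete_bipartite_commute: "complete_bipartite A B = complete_bipartite B A"
  unfolding complete_bipartite_def by (auto simp: insert_commute)

lemma label_degree_complete_bipartite_right:
  assumes "A \<inter> B = {}" "b \<in> B"
  shows "label_degree (complete_bipartite A B) f i b = card ((label_class A B f i)\<inverse> `` {b})"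
proof -
  have "(label_class A B f i)\<inverse> = label_class B A f i"
    by (auto simp: label_class_def insert_commute)
  thus ?thesis
    using label_degree_complete_bipartite_left[of B A b f i] assms
    by (simp add: complete_bipartite_commute[of A B] Int_commute)
qed

lemma vertex_count_diff:
  assumes "finite (verts G)"
  shows "int (vertex_count G f 1) - int (vertex_count G f 0)
    = (\<Sum>v\<in>verts G. sgn (int (label_degree G f 1 v) - int (label_degree G f 0 v)))"
proof -
  have count: "int (vertex_count G f i)
      = (\<Sum>v\<in>verts G. of_bool (vertex_label G f v = Some i))" for i
    using assms by (simp only: vertex_count_def sum_of_bool_eq Collect_conj_eq Collect_mem_eq)
  show ?thesis
    unfolding count sum_subtractf[symmetric]
    by (rule sum.cong) (auto simp: vertex_label_def)
qed

lemma vertex_count_diff_complete_bipartite: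
  assumes "finite A" "finite B" "A \<inter> B = {}" "card A = 2 * g" "card B = 2 * h"
    and f: "f \<in> edges (complete_bipartite A B) \<rightarrow> {0, 1}"
  shows "int (vertex_count (complete_bipartite A B) f 1)
      - int (vertex_count (complete_bipartite A B) f 0)
    = imbalance A B g h (label_class A B f 1)"
proof -
  let ?G = "complete_bipartite A B" and ?X = "label_class A B f 1"
  have verts: "verts ?G = A \<union> B"
    by (simp add: complete_bipartite_def)
  have rows: "(A \<times> B - ?X) `` {a} = B - ?X `` {a}" "?X `` {a} \<subseteq> B" if "a \<in> A" for a
    using that label_class_subset[of A B f 1] by auto
  have cols: "(A \<times> B - ?X)\<inverse> `` {b} = A - ?X\<inverse> `` {b}" "?X\<inverse> `` {b} \<subseteq> A" if "b \<in> B" for b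
    using that label_class_subset[of A B f 1] by auto
  have "int (vertex_count ?G f 1) - int (vertex_count ?G f 0)
    = (\<Sum>v\<in>A \<union> B. sgn (int (label_degree ?G f 1 v) - int (label_degree ?G f 0 v)))"
    using vertex_count_diff[of ?G f] assms(1,2) by (simp add: verts)
  also have "\<dots> = imbalance A B g h ?X"
    unfolding imbalance_def sum.union_disjoint[OF assms(1-3)]
    by (intro arg_cong2[where f = plus] sum.cong refl)
      (simp_all add: label_degree_complete_bipartite_left label_degree_complete_bipartite_right
        label_class_0[OF f] rows cols assms sgn_card_Diff_half del: One_nat_def)
  finally show ?thesis .
qed

text \<open>The number of edges, \<open>4 * g * h\<close>, is even, so \<open>e(1) - e(0)\<close> is
  even too, and at most 1 in absolute value only if it is 0.\<close>

lemma edge_friendly_complete_bipartite: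
  assumes "finite A" "finite B" "A \<inter> B = {}" "card A = 2 * g" "card B = 2 * h"
    and f: "f \<in> edges (complete_bipartite A B) \<rightarrow> {0, 1}"
  shows "edge_friendly (complete_bipartite A B) f \<longleftrightarrow> card (label_class A B f 1) = 2 * g * h"
proof -
  let ?X = "label_class A B f 1"
  have "card (A \<times> B) = 4 * (g * h)"
    using assms by (simp add: card_cartesian_product)
  moreover have "card ?X \<le> card (A \<times> B)"
    using assms by (intro card_mono label_class_subset) auto
  moreover have "card (A \<times> B - ?X) = card (A \<times> B) - card ?X"
    using assms label_class_subset by (metis card_Diff_subset finite_SigmaI finite_subset)
  ultimately have "int (card (A \<times> B - ?X)) = 4 * int (g * h) - int (card ?X)"
    by (simp add: of_nat_diff)
  moreover have "\<bar>int c - (4 * int w - int c)\<bar> \<le> 1 \<longleftrightarrow> c = 2 * w" for c w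
    by presburger
  ultimately show ?thesis
    unfolding edge_friendly_def edge_count_complete_bipartite[OF assms(3)] label_class_0[OF f]
    using f by (simp only: mult.assoc simp_thms)
qed

section \<open>The index set in terms of cell sets\<close>

lemma EBI_complete_bipartite:
  assumes "finite A" "finite B" "A \<inter> B = {}" "card A = 2 * g" "card B = 2 * h"
  shows "EBI (complete_bipartite A B)
    = {\<bar>imbalance A B g h X\<bar> | X. X \<subseteq> A \<times> B \<and> card X = 2 * g * h}" (is "_ = ?R")
proof
  show "EBI (complete_bipartite A B) \<subseteq> ?R"
  proof
    fix z assume "z \<in> EBI (complete_bipartite A B)"
    then obtain f where fr: "edge_friendly (complete_bipartite A B) f"
      and z: "z = \<bar>int (vertex_count (complete_bipartite A B) f 1)
        - int (vertex_count (complete_bipartite A B) f 0)\<bar>"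
      by (auto simp: EBI_def)
    have f: "f \<in> edges (complete_bipartite A B) \<rightarrow> {0, 1}"
      using fr by (simp add: edge_friendly_def)
    show "z \<in> ?R"
      using fr label_class_subset[of A B f 1]
      unfolding z vertex_count_diff_complete_bipartite[OF assms f]
        edge_friendly_complete_bipartite[OF assms f] by blast
  qed
  show "?R \<subseteq> EBI (complete_bipartite A B)"
  proof
    fix z assume "z \<in> ?R"
    then obtain X where X: "X \<subseteq> A \<times> B" "card X = 2 * g * h" and z: "z = \<bar>imbalance A B g h X\<bar>"
      by auto
    define f where "f e = (if e \<in> (\<lambda>(a, b). {a, b}) ` X then 1 else 0 :: nat)" for e
    have f: "f \<in> edges (complete_bipartite A B) \<rightarrow> {0, 1}"
      by (simp add: f_def)
    \<comment> \<open>Since the parts are disjoint, an edge cannot come from a reversed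
      pair.\<close>
    have "{a, b} \<in> (\<lambda>(a, b). {a, b}) ` X \<longleftrightarrow> (a, b) \<in> X" if "a \<in> A" "b \<in> B" for a b
      using that X(1) assms(3) by (auto simp: image_iff doubleton_eq_iff)
    hence "f {a, b} = 1 \<longleftrightarrow> (a, b) \<in> X" if "a \<in> A" "b \<in> B" for a b
      using that by (simp add: f_def)
    hence "label_class A B f 1 = X"
      using X(1) by (auto simp: label_class_def)
    thus "z \<in> EBI (complete_bipartite A B)"
      using vertex_count_diff_complete_bipartite[OF assms f]
        edge_friendly_complete_bipartite[OF assms f] X(2) z
      unfolding EBI_def mem_Collect_eq by metis
  qed
qed

text \<open>The complement has \<open>T\<close> cells as well and the opposite imbalance, so the
  upper bound holds for the absolute value. Requiring only \<open>1 \<le> h\<close> admits the case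
  \<open>n = 2\<close>.\<close>

lemma EBI_complete_bipartite_le:
  assumes "finite A" "finite B" "A \<inter> B = {}" "card A = 2 * g" "card B = 2 * h"
    and "1 \<le> g" "1 \<le> h"
  defines "T \<equiv> 2 * g * h"
  shows "EBI (complete_bipartite A B)
    \<subseteq> {0 .. int (T div (h + 1)) + int ((T + 1) div (h + 1))
           + int (T div (g + 1)) + int ((T + 1) div (g + 1)) - 2 * int g - 2 * int h}"
proof
  fix z assume "z \<in> EBI (complete_bipartite A B)"
  then obtain X where X: "X \<subseteq> A \<times> B" "card X = T" and z: "z = \<bar>imbalance A B g h X\<bar>"
    unfolding EBI_complete_bipartite[OF assms(1-5)] T_def by auto
  have "card (A \<times> B - X) = T"
    using assms X by (simp add: card_Diff_subset finite_subset card_cartesian_product)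
  hence "imbalance A B g h (A \<times> B - X) \<le> int (T div (h + 1)) + int ((T + 1) div (h + 1))
      - int (card A) + (int (T div (g + 1)) + int ((T + 1) div (g + 1)) - int (card B))"
    using assms by (intro imbalance_le) auto
  moreover note imbalance_le[OF assms(1,2) X(1) assms(6,7) X(2)]
    imbalance_complement[OF assms(1,2,4,5) X(1)]
  ultimately show "z \<in> {0 .. int (T div (h + 1)) + int ((T + 1) div (h + 1))
           + int (T div (g + 1)) + int ((T + 1) div (g + 1)) - 2 * int g - 2 * int h}"
    unfolding z assms(4,5) by simp
qed

text \<open>The intermediate values are taken between an extremal set and its complement, whose
  imbalance is at most \<open>- ?M\<close>, hence at most \<open>z\<close>.\<close>

lemma EBI_complete_bipartite_eq:
  assumes "finite A" "finite B" "A \<inter> B = {}" "card A = 2 * g" "card B = 2 * h"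
    and "2 \<le> g" "2 \<le> h"
  defines "T \<equiv> 2 * g * h"
  shows "EBI (complete_bipartite A B)
    = {0 .. int (T div (h + 1)) + int ((T + 1) div (h + 1))
           + int (T div (g + 1)) + int ((T + 1) div (g + 1)) - 2 * int g - 2 * int h}"
    (is "_ = {0 .. ?M}")
proof
  show "EBI (complete_bipartite A B) \<subseteq> {0 .. ?M}"
    unfolding T_def using assms by (intro EBI_complete_bipartite_le) auto
  show "{0 .. ?M} \<subseteq> EBI (complete_bipartite A B)"
  proof
    fix z assume z: "z \<in> {0 .. ?M}"
    obtain X where X: "X \<subseteq> A \<times> B" "card X = T" "?M \<le> imbalance A B g h X"
      using imbalance_attains[OF assms(1,2,4-7)] unfolding T_def assms(4,5) by auto
    have "card (A \<times> B - X) = T"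
      using assms X by (simp add: card_Diff_subset finite_subset card_cartesian_product)
    then obtain Z where "Z \<subseteq> A \<times> B" "card Z = T" "imbalance A B g h Z = z"
      using imbalance_intermediate[of A B X "A \<times> B - X" g h z] X z assms(1,2)
        imbalance_complement[OF assms(1,2,4,5) X(1)] by fastforce
    moreover have "z = \<bar>z\<bar>"
      using z by simp
    ultimately show "z \<in> EBI (complete_bipartite A B)"
      unfolding EBI_complete_bipartite[OF assms(1-5)] T_def mem_Collect_eq by metis
  qed
qed

text \<open>Adding 1 completes a further multiple of \<open>h + 1\<close> exactly at the maximal
  remainder; this produces the case distinction of the theorem.\<close>

lemma Suc_div_eq_if:
  fixes T h :: nat
  shows "(T + 1) div (h + 1) = T div (h + 1) + (if T mod (h + 1) = h then 1 else 0)"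
  by (simp add: div_Suc mod_Suc)

theorem theorem1:
  fixes A B :: "'a set" and m n :: nat
  assumes "finite A" and "finite B" and "A \<inter> B = {}"
    and "card A = m" and "card B = n"
    and "even m" and "even n" and "0 < n" and "n \<le> m"
  shows "(n = 2 \<longrightarrow> EBI (complete_bipartite A B) = {0}) \<and>
    (4 \<le> n \<longrightarrow>
      (let k = m * n div (n + 2);
           k' = (m * n div 2) mod (n div 2 + 1);
           j = m * n div (m + 2);
           j' = (m * n div 2) mod (m div 2 + 1)
       in (k' = n div 2 \<and> j' = m div 2 \<longrightarrow>
             EBI (complete_bipartite A B) = {0 .. 2 * (int k + int j) + 2 - int m - int n}) \<and>
          ((k' = n div 2) \<noteq> (j' = m div 2) \<longrightarrow>
             EBI (complete_bipartite A B) = {0 .. 2 * (int k + int j) + 1 - int m - int n}) \<and>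
          (k' < n div 2 \<and> j' < m div 2 \<longrightarrow>
             EBI (complete_bipartite A B) = {0 .. 2 * (int k + int j) - int m - int n})))"
proof -
  obtain g h where gh: "m = 2 * g" "n = 2 * h"
    using assms(6,7) by (auto elim!: evenE)
  have card: "card A = 2 * g" "card B = 2 * h"
    using assms(4,5) gh by auto
  define T where "T = 2 * g * h"
  have "m * n div 2 = T"
    by (simp add: gh T_def)
  have half: "2 * T div (2 * t + 2) = T div (t + 1)" for t
    using div_mult_mult1[of 2 T "t + 1"] by (simp add: algebra_simps)
  have "m * n div (n + 2) = T div (h + 1)" "m * n div (m + 2) = T div (g + 1)"
    using half[of h] half[of g] by (simp_all add: gh T_def algebra_simps)
  have small: "EBI (complete_bipartite A B) = {0}" if "n = 2"
  proof -
    have h: "h = 1" and g: "1 \<le> g"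
      using that gh assms(8,9) by auto
    \<comment> \<open>Here \<open>T = 2 * g\<close>: the column quotients are 1 and the row
      quotients \<open>g\<close>, so the bound is \<open>2 * g + 2 - 2 * g - 2 = 0\<close>.\<close>
    have "T div (g + 1) = 1" "(T + 1) div (g + 1) = 1"
      using g unfolding T_def h by (auto intro!: div_nat_eqI)
    moreover have "T div (h + 1) = g" "(T + 1) div (h + 1) = g"
      unfolding T_def h by (auto intro!: div_nat_eqI)
    ultimately have "EBI (complete_bipartite A B) \<subseteq> {0}"
      using EBI_complete_bipartite_le[OF assms(1-3) card g] h unfolding T_def by simp
    \<comment> \<open>That 0 occurs follows as soon as some edge-friendly labeling exists.\<close>
    moreover have "EBI (complete_bipartite A B) \<noteq> {}"
    proof -
      have "2 * g * h \<le> card (A \<times> B)"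
        using card by (simp add: card_cartesian_product)
      then obtain X where "X \<subseteq> A \<times> B" "card X = 2 * g * h"
        using obtain_subset_with_card_n by metis
      thus ?thesis
        unfolding EBI_complete_bipartite[OF assms(1-3) card] by blast
    qed
    ultimately show ?thesis
      by blast
  qed
  have large: "EBI (complete_bipartite A B)
      = {0 .. 2 * (int (T div (h + 1)) + int (T div (g + 1)))
           + (if T mod (h + 1) = h then 1 else 0) + (if T mod (g + 1) = g then 1 else 0)
           - int m - int n}" if "4 \<le> n"
  proof -
    have "2 \<le> g" "2 \<le> h"
      using that gh assms(9) by auto
    note eq = EBI_complete_bipartite_eq[OF assms(1-3) card this, folded T_def]
    show ?thesis
      unfolding eq Suc_div_eq_if gh by (rule arg_cong[where f = "\<lambda>M. {0..M}"]) simp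
  qed
  have "m div 2 = g" "n div 2 = h"
    using gh by auto
  thus ?thesis
    using small large \<open>m * n div 2 = T\<close> \<open>m * n div (n + 2) = T div (h + 1)\<close>
      \<open>m * n div (m + 2) = T div (g + 1)\<close>
    by (simp add: Let_def)
qed

end
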